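(* Let $\lambda\in\mathbb{R}$. As formal power series in $x$ (with coefficients in $\mathbb{R}[[t]]$), \[ \frac{t-1}{t-e_{-\lambda}\big((t-1)x\big)}=\sum_{n=0}^{\infty}A_{n,\lambda}(t)\frac{x^{n}}{n!}. \]
   Context: For $\mu\in\mathbb{R}$, $(y)_{0,\mu}=1$ and $(y)_{n,\mu}=y(y-\mu)\cdots(y-(n-1)\mu)$ for $n\ge1$. The degenerate exponential is $e_{\mu}^{y}(s)=\sum_{n=0}^{\infty}(y)_{n,\mu}\frac{s^{n}}{n!}$ and $e_\mu(s)=e_\mu^1(s)$; in particular $e_{-\lambda}(s)=\sum_{n\ge0}(1)_{n,-\lambda}\frac{s^n}{n!}$. The degenerate Eulerian polynomials $A_{n,\lambda}(t)$ ($n\ge0$) are defined by $\frac{A_{n,\lambda}(t)}{(1-t)^{n+1}}=\sum_{j=0}^{\infty}(j+1)_{n,\lambda}t^{j}$ (as formal power series in $t$). *)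

theory Defs
  imports "HOL-Computational_Algebra.Computational_Algebra"
begin

definition degenerate_falling :: "real \<Rightarrow> real \<Rightarrow> nat \<Rightarrow> real" where
  "degenerate_falling \<mu> y n = (\<Prod>i<n. y - real i * \<mu>)"

definition degenerate_exp :: "real \<Rightarrow> real \<Rightarrow> real fps" where
  "degenerate_exp \<mu> y = Abs_fps (\<lambda>n. degenerate_falling \<mu> y n / fact n)"

definition degenerate_eulerian :: "nat \<Rightarrow> real \<Rightarrow> real poly" where
  "degenerate_eulerian n lam =
     (THE A. fps_of_poly A / (1 - fps_X) ^ (n + 1) =
             Abs_fps (\<lambda>j. degenerate_falling lam (real j + 1) n))"

text \<open>
  The coefficientwise embedding of \<open>\<real>[[x]]\<close> into \<open>\<real>[[t]][[x]]\<close>. In the type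
  \<^typ>\<open>real fps fps\<close> the inner variable is \<open>t = fps_const fps_X\<close> and the outer one is
  \<open>x = fps_X\<close>.
\<close>

definition fps_lift :: "real fps \<Rightarrow> real fps fps" where
  "fps_lift F = Abs_fps (\<lambda>n. fps_const (fps_nth F n))"

lemma fps_divide_one_minus_X_eq_iff:
  fixes F G :: "real fps"
  shows "F / (1 - fps_X) ^ n = G \<longleftrightarrow> F = G * (1 - fps_X) ^ n"
proof -
  have u: "((1 - fps_X) ^ n :: real fps) $ 0 \<noteq> 0"
    by (simp add: fps_nth_power_0)
  hence inv: "inverse ((1 - fps_X) ^ n) * (1 - fps_X) ^ n = (1 :: real fps)"
    by (rule inverse_mult_eq_1)
  show ?thesis
    unfolding fps_divide_unit[OF u]
  proof
    assume "F * inverse ((1 - fps_X) ^ n) = G"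
    hence "G * (1 - fps_X) ^ n = F * (inverse ((1 - fps_X) ^ n) * (1 - fps_X) ^ n)"
      by (simp only: mult.assoc flip: \<open>_ = G\<close>)
    thus "F = G * (1 - fps_X) ^ n" by (simp only: inv mult_1_right)
  next
    assume "F = G * (1 - fps_X) ^ n"
    hence "F * inverse ((1 - fps_X) ^ n) = G * (inverse ((1 - fps_X) ^ n) * (1 - fps_X) ^ n)"
      by (simp only: mult.assoc mult.commute[of "inverse _" "(1 - fps_X) ^ n"])
    thus "F * inverse ((1 - fps_X) ^ n) = G" by (simp only: inv mult_1_right)
  qed
qed

lemma degenerate_eulerian_exists:
  "\<exists>A. fps_of_poly A =
     Abs_fps (\<lambda>j. degenerate_falling lam (real j + 1) n) * (1 - fps_X) ^ (n + 1)"
proof (induction n)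
  case 0
  have "Abs_fps (\<lambda>j. degenerate_falling lam (real j + 1) 0) * (1 - fps_X) ^ (0 + 1) = 1"
    using fps_inverse_gp'
    by (simp add: degenerate_falling_def fps_eq_iff right_diff_distrib)
  thus ?case by (intro exI[of _ 1]) simp
next
  case (Suc n)
  define F where "F n = Abs_fps (\<lambda>j. degenerate_falling lam (real j + 1) n)" for n
  from Suc obtain A where A: "fps_of_poly A = F n * (1 - fps_X) ^ (n + 1)"
    by (auto simp: F_def)
  have F_Suc: "F (Suc n) = fps_X * fps_deriv (F n) + fps_const (1 - real n * lam) * F n"
    by (rule fps_ext) (auto simp: F_def degenerate_falling_def fps_X_mult_nth algebra_simps)
  have dP: "fps_deriv ((1 - fps_X) ^ (n + 1)) = - (of_nat (n + 1) * (1 - fps_X :: real fps) ^ n)"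
    unfolding fps_deriv_power fps_of_nat by (simp add: left_diff_distrib distrib_right)
  have dA: "fps_deriv (fps_of_poly A) =
      fps_deriv (F n) * (1 - fps_X) ^ (n + 1) - of_nat (n + 1) * F n * (1 - fps_X) ^ n"
    unfolding A fps_deriv_mult dP by (simp only: mult.assoc mult.left_commute mult_minus_right) simp
  have "F (Suc n) * (1 - fps_X) ^ (Suc n + 1) =
      fps_X * (1 - fps_X) * fps_deriv (fps_of_poly A) + of_nat (n + 1) * fps_X * fps_of_poly A
      + fps_const (1 - real n * lam) * (1 - fps_X) * fps_of_poly A"
    unfolding F_Suc dA unfolding A by (simp add: algebra_simps)
  also have "\<dots> = fps_of_poly ([:0, 1:] * (1 - [:0, 1:]) * pderiv A + of_nat (n + 1) * [:0, 1:] * A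
      + [:1 - real n * lam:] * (1 - [:0, 1:]) * A)"
    by (simp only: fps_of_poly_add fps_of_poly_mult fps_of_poly_diff fps_of_poly_pderiv
        fps_of_poly_fps_X fps_of_poly_1 fps_of_poly_const of_nat_poly fps_of_nat)
  finally show ?case by (metis F_def)
qed

lemma degenerate_eulerian:
  "fps_of_poly (degenerate_eulerian n lam) / (1 - fps_X) ^ (n + 1) =
     Abs_fps (\<lambda>j. degenerate_falling lam (real j + 1) n)"
proof -
  have "\<exists>!A. fps_of_poly A / (1 - fps_X) ^ (n + 1) =
      Abs_fps (\<lambda>j. degenerate_falling lam (real j + 1) n)"
    unfolding fps_divide_one_minus_X_eq_iff
    using degenerate_eulerian_exists[of lam n] by (metis fps_of_poly_eq_iff)
  from theI'[OF this] show ?thesis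
    unfolding degenerate_eulerian_def .
qed

text \<open>
  Division by a series over \<open>\<real>[[t]]\<close> with constant coefficient \<open>t - 1\<close> is a genuine quotient, since
  \<open>t - 1\<close> is a unit of \<open>\<real>[[t]]\<close>; this covers the denominator \<open>t - e((t - 1) x)\<close>.
\<close>

lemma fps_fps_divide_mult_cancel:
  fixes F G :: "real fps fps"
  assumes "fps_nth G 0 = fps_X - 1"
  shows "F / G * G = F"
proof -
  have "inverse (fps_X - 1) * (fps_X - 1 :: real fps) = 1"
    by (rule inverse_mult_eq_1) simp
  hence inv0: "fps_nth G 0 * inverse (fps_nth G 0) = 1"
      "inverse (fps_nth G 0) * fps_nth G 0 = 1"
    by (simp_all add: assms mult.commute)
  have "G * inverse G = 1"
    by (subst fps_inverse_def) (rule fps_right_inverse[OF inv0(1)])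
  moreover have "fps_nth G 0 \<noteq> 0"
    using inv0 by auto
  hence "subdegree G = 0" by (simp add: subdegree_eq_0)
  hence "F / G = F * inverse G" by (simp add: fps_divide_def)
  ultimately show ?thesis by (simp add: mult.assoc mult.commute[of "inverse G" G])
qed

lemma denominator_nth_0:
  "fps_nth (fps_const fps_X -
     (fps_lift (degenerate_exp \<mu> 1) oo ((fps_const fps_X - 1) * fps_X))) 0 = fps_X - 1"
  by (simp add: fps_lift_def degenerate_exp_def degenerate_falling_def)

end

theory Submission
  imports Defs
begin

text \<open>
  The degenerate exponential is characterised by the differential equation
  \<open>(1 + \<mu> s) E' = y E\<close>, \<open>E(0) = 1\<close>, which makes it multiplicative in the exponent.
  After multiplication by the denominator the \<open>x\<^sup>n\<close>-coefficient of the claim is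
  \<open>(1 - t)\<^bsup>n+1\<^esup> / n!\<close> times
  \<open>t \<Sum>\<^sub>j (j+1)\<^bsub>n,\<lambda>\<^esub> t\<^sup>j - \<Sum>\<^sub>j (j)\<^bsub>n,\<lambda>\<^esub> t\<^sup>j = - (0)\<^bsub>n,\<lambda>\<^esub>\<close>;
  here the second series arises from
  \<open>(-1)\<^sup>k (1)\<^bsub>k,-\<lambda>\<^esub> = (-1)\<^bsub>k,\<lambda>\<^esub>\<close> and multiplicativity,
  \<open>e\<^bsup>-1\<^esup> e\<^bsup>j+1\<^esup> = e\<^bsup>j\<^esup>\<close>.
\<close>

lemma degenerate_falling_Suc:
  "degenerate_falling \<mu> y (Suc n) = degenerate_falling \<mu> y n * (y - real n * \<mu>)"
  by (simp add: degenerate_falling_def)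

lemma degenerate_falling_0: "degenerate_falling \<mu> 0 n = (if n = 0 then 1 else 0)"
  by (auto simp: degenerate_falling_def)

lemma degenerate_falling_minus:
  "degenerate_falling (- \<mu>) (- y) n = (-1) ^ n * degenerate_falling \<mu> y n"
  by (induction n) (simp_all add: degenerate_falling_def algebra_simps)

lemma degenerate_exp_nth: "degenerate_exp \<mu> y $ n = degenerate_falling \<mu> y n / fact n"
  by (simp add: degenerate_exp_def)

lemma degenerate_exp_ode:
  "(1 + fps_const \<mu> * fps_X) * fps_deriv (degenerate_exp \<mu> y) = fps_const y * degenerate_exp \<mu> y"
proof (rule fps_ext)
  fix n
  have rec: "real (Suc k) * degenerate_exp \<mu> y $ Suc k = (y - real k * \<mu>) * degenerate_exp \<mu> y $ k" for k
    by (simp add: degenerate_exp_nth degenerate_falling_Suc del: of_nat_Suc)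
  show "((1 + fps_const \<mu> * fps_X) * fps_deriv (degenerate_exp \<mu> y)) $ n =
      (fps_const y * degenerate_exp \<mu> y) $ n"
    using rec[of n] by (cases n) (simp_all add: distrib_right mult.assoc algebra_simps)
qed

text \<open>Comparing coefficients turns the equation into
  \<open>(n + 1) P $ (n + 1) = (y - n \<mu>) P $ n\<close>, so the constant term determines all
  others.\<close>

lemma degenerate_exp_unique:
  assumes ode: "(1 + fps_const \<mu> * fps_X) * fps_deriv P = fps_const y * P"
    and init: "P $ 0 = 1"
  shows "P = degenerate_exp \<mu> y"
proof (rule fps_ext)
  fix n
  show "P $ n = degenerate_exp \<mu> y $ n"
  proof (induction n)
    case 0
    then show ?case by (simp add: init degenerate_exp_nth degenerate_falling_def)
  next
    case (Suc n)
    have "((1 + fps_const \<mu> * fps_X) * fps_deriv P) $ n = (fps_const y * P) $ n"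
      by (simp only: ode)
    hence "real (Suc n) * P $ Suc n = (y - real n * \<mu>) * P $ n"
      by (cases n) (simp_all add: distrib_right mult.assoc algebra_simps)
    hence "P $ Suc n = (y - real n * \<mu>) * P $ n / real (Suc n)"
      by (simp add: field_simps del: of_nat_Suc)
    thus ?case
      by (simp add: Suc.IH degenerate_exp_nth degenerate_falling_Suc field_simps)
  qed
qed

text \<open>By the product rule the right-hand side solves the equation with parameter
  \<open>y + z\<close>. Coefficientwise this is a Vandermonde convolution.\<close>

lemma degenerate_exp_add: "degenerate_exp \<mu> (y + z) = degenerate_exp \<mu> y * degenerate_exp \<mu> z"
proof (rule degenerate_exp_unique[symmetric])
  let ?L = "1 + fps_const \<mu> * fps_X" and ?E = "degenerate_exp \<mu>"
  have "?L * fps_deriv (?E y * ?E z) = ?E y * (?L * fps_deriv (?E z)) + (?L * fps_deriv (?E y)) * ?E z"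
    by (simp only: fps_deriv_mult distrib_left mult.assoc mult.left_commute)
  also have "\<dots> = fps_const (y + z) * (?E y * ?E z)"
    unfolding degenerate_exp_ode by (simp add: algebra_simps flip: fps_const_add)
  finally show "?L * fps_deriv (?E y * ?E z) = fps_const (y + z) * (?E y * ?E z)" .
qed (simp add: degenerate_exp_nth degenerate_falling_def)

lemma fps_of_poly_degenerate_eulerian:
  "fps_of_poly (degenerate_eulerian n lam) =
     Abs_fps (\<lambda>j. degenerate_falling lam (real j + 1) n) * (1 - fps_X) ^ (n + 1)"
  using degenerate_eulerian[of n lam] by (simp only: fps_divide_one_minus_X_eq_iff)

lemma fps_divide_fact: "(F :: real fps) / fact n = fps_const (1 / fact n) * F"
proof -
  have "fact n = (fps_const (fact n) :: real fps)"
    by (metis fps_of_nat of_nat_fact)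
  thus ?thesis
    by (simp add: fps_divide_unit fps_const_inverse divide_inverse mult.commute)
qed

text \<open>At \<open>t^j\<close> the sum is a Cauchy product, collapsing by multiplicativity to the
  coefficient for exponent \<open>j\<close>. Multiplication by \<open>fps_X\<close> supplies these
  for \<open>j > 0\<close>; the correction is the case \<open>j = 0\<close>.\<close>

lemma degenerate_exp_eulerian_convolution:
  "(\<Sum>k\<le>n. fps_const (degenerate_exp lam (- 1) $ k) *
       Abs_fps (\<lambda>j. degenerate_exp lam (real j + 1) $ (n - k))) =
   fps_X * Abs_fps (\<lambda>j. degenerate_exp lam (real j + 1) $ n) + (if n = 0 then 1 else 0)"
proof (rule fps_ext)
  fix j
  have "(\<Sum>k\<le>n. degenerate_exp lam (- 1) $ k * degenerate_exp lam (real j + 1) $ (n - k)) =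
      degenerate_exp lam (real j) $ n"
    using degenerate_exp_add[of lam "- 1" "real j + 1"] by (simp add: fps_mult_nth atMost_atLeast0)
  thus "(\<Sum>k\<le>n. fps_const (degenerate_exp lam (- 1) $ k) *
       Abs_fps (\<lambda>j. degenerate_exp lam (real j + 1) $ (n - k))) $ j =
   (fps_X * Abs_fps (\<lambda>j. degenerate_exp lam (real j + 1) $ n) + (if n = 0 then 1 else 0)) $ j"
    by (cases j) (simp_all add: fps_sum_nth degenerate_exp_nth degenerate_falling_0 add.commute)
qed

theorem theorem9:
  fixes lam :: real
  shows "(fps_const fps_X - 1) /
           (fps_const fps_X - (fps_lift (degenerate_exp (- lam) 1) oo ((fps_const fps_X - 1) * fps_X)))
         = Abs_fps (\<lambda>n. fps_of_poly (degenerate_eulerian n lam) / fact n)"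
    (is "?N / ?D = ?G")
proof -
  define E where "E = (fps_lift (degenerate_exp (- lam) 1) oo ((fps_const fps_X - 1) * fps_X))"
  define S where "S n = Abs_fps (\<lambda>j. degenerate_exp lam (real j + 1) $ n)" for n
  have G_nth: "?G $ n = S n * (1 - fps_X) ^ (n + 1)" for n
  proof -
    have "S n = fps_const (1 / fact n) * Abs_fps (\<lambda>j. degenerate_falling lam (real j + 1) n)"
      by (rule fps_ext) (simp add: S_def degenerate_exp_nth)
    thus ?thesis
      by (simp only: fps_nth_Abs_fps fps_of_poly_degenerate_eulerian fps_divide_fact mult.assoc)
  qed
  \<comment> \<open>With \<open>t - 1\<close> as a constant of the outer ring, the composition just
    scales the k-th coefficient by \<open>(t - 1)^k\<close>.\<close>
  have "(fps_const fps_X - 1 :: real fps fps) = fps_const (fps_X - 1)"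
    by (simp flip: fps_const_sub)
  hence "E $ k = (fps_X - 1) ^ k * fps_const (degenerate_exp (- lam) 1 $ k)" for k
    by (simp only: E_def fps_compose_linear fps_lift_def fps_nth_Abs_fps)
  moreover have "(fps_X - 1 :: real fps) ^ k = fps_const ((- 1) ^ k) * (1 - fps_X) ^ k" for k
  proof -
    have "fps_X - 1 = fps_const (- 1) * (1 - fps_X :: real fps)"
      by (simp flip: fps_const_neg)
    thus ?thesis by (simp only: power_mult_distrib fps_const_power)
  qed
  moreover have "degenerate_exp lam (- 1) $ k = (- 1) ^ k * degenerate_exp (- lam) 1 $ k" for k
    using degenerate_falling_minus[of "- lam" 1 k] by (simp add: degenerate_exp_nth)
  \<comment> \<open>The sign of \<open>(t - 1)^k\<close> is absorbed by passing from parameters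
    \<open>- lam\<close>, \<open>1\<close> to \<open>lam\<close>, \<open>- 1\<close>.\<close>
  ultimately have E_nth: "E $ k = fps_const (degenerate_exp lam (- 1) $ k) * (1 - fps_X) ^ k" for k
    by (simp add: mult.commute mult.left_commute flip: fps_const_mult)
  have "(?D * ?G) $ n = ?N $ n" for n
  proof -
    have "(E * ?G) $ n = (\<Sum>k\<le>n. E $ k * ?G $ (n - k))"
      by (simp only: fps_mult_nth atMost_atLeast0)
    also have "\<dots> = (\<Sum>k\<le>n. fps_const (degenerate_exp lam (- 1) $ k) * S (n - k)) *
        (1 - fps_X) ^ (n + 1)"
      unfolding sum_distrib_right
    proof (rule sum.cong)
      fix k assume "k \<in> {..n}"
      \<comment> \<open>The powers from \<open>E\<close> and \<open>?G\<close> combine to one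
        independent of \<open>k\<close>, which leaves the sum.\<close>
      hence "(1 - fps_X :: real fps) ^ (n + 1) = (1 - fps_X) ^ k * (1 - fps_X) ^ (n - k + 1)"
        by (simp flip: power_add)
      thus "E $ k * ?G $ (n - k) =
          fps_const (degenerate_exp lam (- 1) $ k) * S (n - k) * (1 - fps_X) ^ (n + 1)"
        unfolding G_nth E_nth by (simp only: mult_ac)
    qed simp
    also have "\<dots> = fps_X * ?G $ n + (if n = 0 then 1 - fps_X else 0)"
      unfolding G_nth S_def degenerate_exp_eulerian_convolution
      by (simp add: distrib_right mult.assoc)
    finally have "(E * ?G) $ n = fps_X * ?G $ n + (if n = 0 then 1 - fps_X else 0)" .
    moreover have "(fps_const fps_X * ?G) $ n = fps_X * ?G $ n"
      by (rule fps_mult_left_const_nth)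
    ultimately have "((fps_const fps_X - E) * ?G) $ n = - (if n = 0 then 1 - fps_X else 0)"
      by (simp only: left_diff_distrib fps_sub_nth) simp
    thus ?thesis unfolding E_def by simp
  qed
  hence "?D * ?G = ?N" by (rule fps_ext)
  \<comment> \<open>The constant coefficient \<open>t - 1\<close> of \<open>?D\<close> is a unit, so
    the division is exact; cancelling the nonzero \<open>?D\<close> then identifies the quotient
    with \<open>?G\<close>.\<close>
  moreover have "?N / ?D * ?D = ?N"
    by (rule fps_fps_divide_mult_cancel) (rule denominator_nth_0)
  ultimately have "?N / ?D * ?D = ?G * ?D"
    by (simp only: mult.commute)
  moreover have D_nonzero: "?D \<noteq> 0"
  proof
    assume "?D = 0"
    hence "?D $ 0 = 0" by simp
    hence "fps_X - 1 = (0 :: real fps)" unfolding denominator_nth_0 .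
    hence "(fps_X - 1 :: real fps) $ 0 = 0" by (simp only: fps_zero_nth)
    thus False by simp
  qed
  ultimately show ?thesis
    using mult_right_cancel[OF D_nonzero] by blast
qed

end
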